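(* Let $X$ be a compact metrizable space endowed with its Borel $\sigma$-algebra, and let $S\subseteq X^\infty$ be an arbitrary subset. Then for any stationary probability measure $\mu$ on $X^\infty$ with $\mathrm{Support}(\mu)\subseteq S$ we have $$H^{ip}(\mu)\leq H^{tip}(S).$$
   Context: $X^\infty=\prod_{n=0}^\infty X$ carries the product topology and the product $\sigma$-algebra (which here equals its Borel $\sigma$-algebra). $\mathrm{Support}(\mu)$ is the topological support of $\mu$ (the smallest closed set of full $\mu$-measure). A probability measure $\mu$ on $X^\infty$ is stationary if it is preserved by the shift $\mathfrak{S}(x_0,x_1,x_2,\ldots)=(x_1,x_2,\ldots)$, i.e. $\mathfrak{S}_*\mu=\mu$. For subsets $A_0,\ldots,A_{n-1}$ of $X$ put $\overline{A_0\cdots A_{n-1}}=A_0\times\cdots\times A_{n-1}\times X\times X\times\cdots\subseteq X^\infty$, and for a family $\mathcal{A}=\{A_i\}_{i\in I}$ of subsets of $X$ put $\overline{\mathcal{A}}^n=\{\overline{A_{i_0}\cdots A_{i_{n-1}}}:i_0,\ldots,i_{n-1}\in I\}$. Infinite-product entropy of a measure: a partition of a measurable space is a finite collection of pairwise disjoint measurable sets whose union is the whole space. For a probability measure $\nu$ and a partition $\mathcal{P}=\{A_i\}_{i=1}^k$, $H^{sh}(\nu,\mathcal{P})=-\sum_{i=1}^k\nu(A_i)\log\nu(A_i)$ (with $0\log0=0$). For a partition $\mathcal{P}$ of $X$, $\overline{\mathcal{P}}^n$ is a partition of $X^\infty$; set $H^{ip}(\mu,\mathcal{P})=\limsup_{n\to\infty}\frac1n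 H^{sh}(\mu,\overline{\mathcal{P}}^n)$ and $H^{ip}(\mu)=\sup_{\mathcal{P}}H^{ip}(\mu,\mathcal{P})\in[0,\infty]$, the supremum over all partitions $\mathcal{P}$ of $X$. Topological infinite-product entropy of a subset $S\subseteq X^\infty$: for an open cover $\mathcal{U}$ of $X$, $\overline{\mathcal{U}}^n$ is an open cover of $X^\infty$. Let $N_S(\overline{\mathcal{U}}^n)$ be the minimum of the cardinalities $|\mathcal{A}|$ over all subfamilies $\mathcal{A}\subseteq\overline{\mathcal{U}}^n$ with $S\subseteq\bigcup\mathcal{A}$, let $H^{tip}(S,\mathcal{U})=\limsup_{n\to\infty}\frac1n\log N_S(\overline{\mathcal{U}}^n)$, and let $H^{tip}(S)=\sup_{\mathcal{U}}H^{tip}(S,\mathcal{U})$, the supremum over all open covers $\mathcal{U}$ of $X$. *)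

theory Defs
  imports "HOL-Probability.Probability"
begin

text \<open>
  The space \<open>X\<close> is a topological type \<open>'a\<close>; points of \<open>X\<^sup>\<infinity>\<close> are functions \<open>nat \<Rightarrow> 'a\<close>, which carry
  the product topology by the type class instance for functions. All logarithms are natural.
\<close>

definition shift :: "(nat \<Rightarrow> 'a) \<Rightarrow> nat \<Rightarrow> 'a" where
  "shift x = (\<lambda>n. x (Suc n))"

definition stationary :: "(nat \<Rightarrow> 'a::topological_space) measure \<Rightarrow> bool" where
  "stationary \<mu> \<longleftrightarrow> distr \<mu> \<mu> shift = \<mu>"

text \<open>
  Meant for probability measures. The smallest closed set of full measure, when there is one, is
  the intersection of all closed sets of full measure.
\<close>

definition top_support :: "'b::topological_space measure \<Rightarrow> 'b set" where
  "top_support \<mu> = \<Inter>{C. closed C \<and> C \<in> sets \<mu> \<and> emeasure \<mu> C = 1}"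

definition cylinder :: "nat \<Rightarrow> (nat \<Rightarrow> 'a set) \<Rightarrow> (nat \<Rightarrow> 'a) set" where
  "cylinder n A = {x. \<forall>j<n. x j \<in> A j}"

text \<open>Only the first \<open>n\<close> entries of the sequence \<open>A\<close> matter, both here and in \<open>cylinder\<close>.\<close>

definition cylinders :: "nat \<Rightarrow> 'a set set \<Rightarrow> (nat \<Rightarrow> 'a) set set" where
  "cylinders n \<A> = {cylinder n A | A. \<forall>j<n. A j \<in> \<A>}"

definition meas_partition :: "'b measure \<Rightarrow> 'b set set \<Rightarrow> bool" where
  "meas_partition M P \<longleftrightarrow> finite P \<and> P \<subseteq> sets M \<and> disjoint P \<and> \<Union>P = space M"

definition H_sh :: "'b measure \<Rightarrow> 'b set set \<Rightarrow> real" where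
  "H_sh \<nu> P = - (\<Sum>A\<in>P. measure \<nu> A * ln (measure \<nu> A))"

definition H_ip_part :: "(nat \<Rightarrow> 'a) measure \<Rightarrow> 'a set set \<Rightarrow> ereal" where
  "H_ip_part \<mu> P = limsup (\<lambda>n. ereal (H_sh \<mu> (cylinders n P) / real n))"

definition H_ip :: "(nat \<Rightarrow> 'a::topological_space) measure \<Rightarrow> ereal" where
  "H_ip \<mu> = (SUP P\<in>{P. meas_partition (borel :: 'a measure) P}. H_ip_part \<mu> P)"

definition open_cover :: "'a::topological_space set set \<Rightarrow> bool" where
  "open_cover \<U> \<longleftrightarrow> (\<forall>U\<in>\<U>. open U) \<and> \<Union>\<U> = UNIV"

text \<open>
  Finiteness of \<open>\<A>\<close> is required because \<open>card\<close> is \<open>0\<close> on infinite sets. When \<open>X\<close> is compact and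
  \<open>\<V> = cylinders n \<U>\<close> for an open cover \<open>\<U>\<close> of \<open>X\<close>, finite subcovers exist, so this is the minimum
  over all subcovers. It is \<open>0\<close> only for \<open>S = {}\<close>.
\<close>

definition cover_number :: "'b set \<Rightarrow> 'b set set \<Rightarrow> nat" where
  "cover_number S \<V> = Inf (card ` {\<A>. finite \<A> \<and> \<A> \<subseteq> \<V> \<and> S \<subseteq> \<Union>\<A>})"

definition H_tip_cover :: "(nat \<Rightarrow> 'a) set \<Rightarrow> 'a set set \<Rightarrow> ereal" where
  "H_tip_cover S \<U> = limsup (\<lambda>n. ereal (ln (real (cover_number S (cylinders n \<U>))) / real n))"

definition H_tip :: "(nat \<Rightarrow> 'a::topological_space) set \<Rightarrow> ereal" where
  "H_tip S = (SUP \<U>\<in>{\<U>. open_cover \<U>}. H_tip_cover S \<U>)"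

end

theory Submission
  imports Defs
begin

text \<open>
  Given a partition \<open>P\<close> of \<open>X\<close>, regularity yields closed sets \<open>B A \<subseteq> A\<close> for \<open>A \<in> P\<close> such that each \<open>A - B A\<close>
  has small measure. Let \<open>r y\<close> be \<open>None\<close> if \<open>y\<close> lies in some \<open>B A\<close>, and otherwise the cell of \<open>P\<close>
  containing \<open>y\<close>; this variable has small entropy. The sets \<open>W A = - (\<Union>A'\<noteq>A. B A')\<close> form an open cover,
  and a point \<open>y \<in> W A\<close> with \<open>r y = None\<close> must lie in \<open>A\<close>. Hence the \<open>P\<close>-word of length \<open>n\<close> of a
  sequence \<open>x\<close> is determined by an element containing \<open>x\<close> of a minimal cover of \<open>S\<close> by cylinders over \<open>W\<close>,
  together with \<open>r (x 0), \<dots>, r (x (n - 1))\<close>. Subadditivity of entropy and stationarity bound the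
  entropy of the words by \<open>ln N + n H(r)\<close>, with \<open>N\<close> the size of the cover. Unlike in Misiurewicz's
  argument, no summand \<open>ln 2\<close> arises that would have to be removed by passing to powers of the shift.
\<close>

section \<open>Regularity of measures, compactness and supports\<close>

text \<open>Good-sets argument along the generation of the Borel sets from the open sets. The claim
  is proved for all \<open>e\<close> at once, so that the union step can ask for geometrically
  decaying errors. Metrizability enters through open sets being F-sigma.\<close>

lemma regular_metrizable:
  fixes M :: "'a::topological_space measure"
  assumes met: "metrizable_space (euclidean :: 'a topology)"
    and "finite_measure M" and sM: "sets M = sets borel"
    and "A \<in> sets borel" and "e > 0"
  shows "\<exists>C U. closed C \<and> open U \<and> C \<subseteq> A \<and> A \<subseteq> U \<and> measure M (U - C) < e"
proof -
  interpret finite_measure M by fact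
  have clM [measurable]: "closed C \<Longrightarrow> C \<in> sets M" "open C \<Longrightarrow> C \<in> sets M" for C
    by (simp_all add: sM)
  have "A \<in> sigma_sets UNIV {S. open S}"
    using assms(4) by (simp add: borel_def)
  then have "\<forall>e>0. \<exists>C U. closed C \<and> open U \<and> C \<subseteq> A \<and> A \<subseteq> U \<and> measure M (U - C) < e"
  proof induction
    case (Basic U)
    then have U: "open U" by simp
    \<comment> \<open>An open set is its own outer approximation; closed sets increasing to it
      exhaust its measure from inside.\<close>
    then have "fsigma_in euclidean U"
      using open_imp_fsigma_in[OF met, of U] by simp
    then obtain C where C: "\<And>n::nat. closed (C n)" "\<And>n. C n \<subseteq> C (Suc n)" "(\<Union>n. C n) = U"
      unfolding fsigma_in_ascending closed_closedin[symmetric] by blast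
    have "(\<lambda>n. measure M (U - C n)) \<longlonglongrightarrow> measure M (\<Inter>n. U - C n)"
      using U C by (intro finite_Lim_measure_decseq) (auto intro!: decseq_SucI)
    moreover have "(\<Inter>n. U - C n) = {}"
      using C(3) by auto
    ultimately have lim: "(\<lambda>n. measure M (U - C n)) \<longlonglongrightarrow> 0"
      by (metis measure_empty)
    show ?case
    proof (intro allI impI)
      fix e :: real assume "e > 0"
      then obtain n where "measure M (U - C n) < e"
        using order_tendstoD(2)[OF lim] eventually_happens by fastforce
      then show "\<exists>C V. closed C \<and> open V \<and> C \<subseteq> U \<and> U \<subseteq> V \<and> measure M (V - C) < e"
        using U C by blast
    qed
  next
    case Empty
    then show ?case by (auto intro!: exI[of _ "{}"])
  next
    case (Compl A)
    show ?case
    proof (intro allI impI)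
      fix e :: real assume "e > 0"
      then obtain C U where *: "closed C" "open U" "C \<subseteq> A" "A \<subseteq> U" "measure M (U - C) < e"
        using Compl by meson
      moreover have "- C - - U = U - C" by auto
      ultimately show "\<exists>C U. closed C \<and> open U \<and> C \<subseteq> UNIV - A \<and> UNIV - A \<subseteq> U \<and> measure M (U - C) < e"
        by (intro exI[of _ "- U"] exI[of _ "- C"]) auto
    qed
  next
    case (Union A)
    show ?case
    proof (intro allI impI)
      fix e :: real assume e: "e > 0"
      have "\<forall>i. \<exists>C U. closed C \<and> open U \<and> C \<subseteq> A i \<and> A i \<subseteq> U \<and> measure M (U - C) < e/2 * (1/2)^Suc i"
      proof
        fix i
        have "0 < e/2 * (1/2)^Suc i"
          using e by simp
        with Union.IH[of i]
        show "\<exists>C U. closed C \<and> open U \<and> C \<subseteq> A i \<and> A i \<subseteq> U \<and> measure M (U - C) < e/2 * (1/2)^Suc i"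
          by (metis (no_types))
      qed
      then obtain C U where CU: "\<And>i. closed (C i)" "\<And>i. open (U i)" "\<And>i. C i \<subseteq> A i" "\<And>i. A i \<subseteq> U i"
        "\<And>i. measure M (U i - C i) < e/2 * (1/2)^Suc i"
        by metis
      \<comment> \<open>The union of all \<open>C i\<close> need not be closed, so finite unions
        \<open>?D n\<close> are taken. The rest \<open>?V - ?D n\<close> decreases to a set inside
        the union of the \<open>U i - C i\<close>, of measure at most \<open>e/2\<close>; this slack
        below \<open>e\<close> lets some finite \<open>n\<close> suffice.\<close>
      let ?V = "\<Union>i. U i" and ?D = "\<lambda>n. \<Union>i<n. C i"
      have sums: "(\<lambda>i. e/2 * (1/2)^Suc i) sums (e/2)"
        using sums_mult[OF power_half_series, of "e/2"] by simp
      have sm: "summable (\<lambda>i. measure M (U i - C i))"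
        by (rule summable_comparison_test'[OF sums_summable[OF sums], of 0])
           (use CU(5) in \<open>auto intro: less_imp_le\<close>)
      have [measurable]: "U i \<in> sets M" "C i \<in> sets M" for i
        using CU by auto
      have "measure M (\<Inter>n. ?V - ?D n) \<le> measure M (\<Union>i. U i - C i)"
        by (rule finite_measure_mono) auto
      also have "\<dots> \<le> (\<Sum>i. measure M (U i - C i))"
        by (rule finite_measure_subadditive_countably) (use sm in auto)
      also have "\<dots> \<le> e/2"
        using suminf_le[OF less_imp_le[OF CU(5)] sm sums_summable[OF sums]] sums_unique[OF sums]
        by simp
      finally have le: "measure M (\<Inter>n. ?V - ?D n) < e"
        using e by simp
      have "(\<lambda>n. measure M (?V - ?D n)) \<longlonglongrightarrow> measure M (\<Inter>n. ?V - ?D n)"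
        by (intro finite_Lim_measure_decseq) (auto intro!: decseq_SucI)
      from order_tendstoD(2)[OF this le] obtain n where n: "measure M (?V - ?D n) < e"
        using eventually_happens by fastforce
      have "closed (?D n)" "open ?V"
        using CU(1,2) by auto
      moreover have "?D n \<subseteq> (\<Union>i. A i)"
        using CU(3) by blast
      moreover have "(\<Union>i. A i) \<subseteq> ?V"
        using CU(4) by blast
      ultimately show "\<exists>C V. closed C \<and> open V \<and> C \<subseteq> (\<Union>i. A i) \<and> (\<Union>i. A i) \<subseteq> V \<and> measure M (V - C) < e"
        using n by blast
    qed
  qed
  then show ?thesis using \<open>e > 0\<close> by blast
qed

lemma compact_UNIV_fun:
  assumes "compact (UNIV :: 'a::topological_space set)"
  shows "compact (UNIV :: ('i \<Rightarrow> 'a) set)"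
proof -
  have "compact_space (euclidean :: 'a topology)"
    using assms by (simp add: compact_space_def)
  then have "compact_space (product_topology (\<lambda>_::'i. euclidean :: 'a topology) UNIV)"
    by (simp add: compact_space_product_topology)
  then show ?thesis
    by (simp add: euclidean_product_topology compact_space_def)
qed

text \<open>An intersection of uncountably many sets of full measure need not have full measure.
  Compactness of \<open>- G\<close> selects finitely many of the closed sets defining the support
  whose intersection already lies in \<open>G\<close>.\<close>

lemma open_superset_top_support:
  fixes M :: "'b::topological_space measure"
  assumes "compact (UNIV :: 'b set)" and "prob_space M" and "space M = UNIV"
    and "open G" and "G \<in> sets M" and "top_support M \<subseteq> G"
  shows "AE x in M. x \<in> G"
proof -
  interpret prob_space M by fact
  define \<C> where "\<C> = {C. closed C \<and> C \<in> sets M \<and> emeasure M C = 1}"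
  have "compact (- G)"
    using compact_Int_closed[of UNIV "- G"] assms by (simp add: closed_Compl)
  moreover have "- G \<inter> \<Inter>\<C> = {}"
    using assms(6) by (auto simp: top_support_def \<C>_def)
  ultimately obtain F where F: "finite F" "F \<subseteq> \<C>" "- G \<inter> \<Inter>F = {}"
    using compact_imp_fip[of "- G" \<C>] by (auto simp: \<C>_def)
  have "AE x in M. x \<in> C" if "C \<in> F" for C
    using F that by (auto simp: \<C>_def AE_in_set_eq_1 emeasure_eq_measure)
  then have "AE x in M. \<forall>C\<in>F. x \<in> C"
    using F(1) by (simp add: AE_finite_all)
  then show ?thesis
    by eventually_elim (use F(3) in blast)
qed

section \<open>Entropy of simple random variables\<close>

text \<open>Values outside the range have probability \<open>0\<close> and contribute nothing.
  Summing over a common \<open>V\<close> allows variables with different ranges to be compared term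
  by term.\<close>

lemma (in information_space) entropy_eq_sum:
  assumes X: "simple_function M X" and "finite V" and "X ` space M \<subseteq> V"
  shows "\<H>(X) = - (\<Sum>v\<in>V. prob (X -` {v} \<inter> space M) * log b (prob (X -` {v} \<inter> space M)))"
proof -
  have "X -` {v} \<inter> space M = {}" if "v \<notin> X ` space M" for v
    using that by auto
  then show ?thesis
    unfolding entropy_simple_distributed[OF simple_distributedI[OF X measure_nonneg refl]]
    by (intro arg_cong[where f = uminus] sum.mono_neutral_left) (use assms(2,3) in auto)
qed

lemma (in information_space) entropy_Pair_le:
  assumes "simple_function M X" and "simple_function M Y"
  shows "\<H>(\<lambda>x. (X x, Y x)) \<le> \<H>(X) + \<H>(Y)"
  using entropy_chain_rule[OF assms] conditional_entropy_less_eq_entropy[OF assms(2,1)] by simp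

lemma simple_function_map_upt:
  assumes "\<And>j::nat. j < n \<Longrightarrow> simple_function M (Y j)"
  shows "simple_function M (\<lambda>x. map (\<lambda>j. Y j x) [0..<n])"
  using assms
proof (induction n)
  case 0
  then show ?case by simp
next
  case (Suc n)
  then have "simple_function M (\<lambda>x. map (\<lambda>j. Y j x) [0..<n])" "simple_function M (Y n)"
    by simp_all
  from simple_function_compose2[OF this, of "\<lambda>zs z. zs @ [z]"] show ?case
    by simp
qed

lemma (in information_space) entropy_map_upt_le:
  assumes "\<And>j::nat. j < n \<Longrightarrow> simple_function M (Y j)"
  shows "\<H>(\<lambda>x. map (\<lambda>j. Y j x) [0..<n]) \<le> (\<Sum>j<n. \<H>(Y j))"
  using assms
proof (induction n)
  case 0
  have "\<H>(\<lambda>_. [] :: 'b list) = 0"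
    by (subst entropy_eq_sum[where V = "{[]}"]) (auto simp: prob_space)
  then show ?case
    by simp
next
  case (Suc n)
  let ?Z = "\<lambda>x. map (\<lambda>j. Y j x) [0..<n]"
  have Y: "simple_function M (Y n)" and Z: "simple_function M ?Z"
    using Suc.prems by (auto intro: simple_function_map_upt)
  \<comment> \<open>The longer word is a function of the pair of shorter word and last letter, so
    data processing reduces the step to subadditivity for pairs.\<close>
  have eq: "(\<lambda>x. map (\<lambda>j. Y j x) [0..<Suc n]) = (\<lambda>(zs, z). zs @ [z]) \<circ> (\<lambda>x. (?Z x, Y n x))"
    by auto
  have "\<H>(\<lambda>x. map (\<lambda>j. Y j x) [0..<Suc n]) \<le> \<H>(\<lambda>x. (?Z x, Y n x))"
    unfolding eq by (rule entropy_data_processing[OF simple_function_Pair[OF Z Y]])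
  also have "\<dots> \<le> \<H>(?Z) + \<H>(Y n)"
    by (rule entropy_Pair_le[OF Z Y])
  finally show ?case
    using Suc by simp
qed

text \<open>Both bounds come from \<open>ln t \<le> t - 1\<close>, with
  \<open>t = 1 / sqrt p\<close> and \<open>t = 1 / p\<close>. The first is meant for values of small
  probability, the second for the one value of probability near \<open>1\<close>.\<close>

lemma minus_mult_ln_le:
  fixes p :: real
  assumes "0 \<le> p"
  shows "- (p * ln p) \<le> 2 * sqrt p" and "- (p * ln p) \<le> 1 - p"
proof -
  have sq: "- (p * ln p) \<le> 2 * sqrt p \<and> - (p * ln p) \<le> 1 - p" if p: "0 < p"
  proof
    have "- ln p \<le> 1 / p - 1"
      using ln_le_minus_one[of "1 / p"] p by (simp add: ln_div)
    then have "p * - ln p \<le> p * (1 / p - 1)"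
      using p by (intro mult_left_mono) auto
    then show "- (p * ln p) \<le> 1 - p"
      using p by (simp add: algebra_simps)
    have "- ln p = 2 * ln (1 / sqrt p)"
      using p by (simp add: ln_div ln_sqrt)
    also have "\<dots> \<le> 2 * (1 / sqrt p)"
      using ln_le_minus_one[of "1 / sqrt p"] p by simp
    finally have "p * - ln p \<le> p * (2 * (1 / sqrt p))"
      using p by (intro mult_left_mono) auto
    also have "p * (2 * (1 / sqrt p)) = 2 * (p / sqrt p)"
      by simp
    also have "p / sqrt p = sqrt p"
      using p by (simp add: real_div_sqrt)
    finally show "- (p * ln p) \<le> 2 * sqrt p"
      by simp
  qed
  show "- (p * ln p) \<le> 2 * sqrt p" and "- (p * ln p) \<le> 1 - p"
    using sq assms by (cases "p = 0"; force)+
qed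

text \<open>The entropy term of \<open>None\<close> is at most the total mass of the other values.
  Each \<open>Some v\<close> of mass \<open>p\<close> thus accounts for at most
  \<open>p + 2 * sqrt p \<le> 3 * sqrt d\<close>, which explains the factor
  \<open>3\<close>.\<close>

lemma (in information_space) entropy_option_le:
  assumes b: "b = exp 1" and X: "simple_function M X" and "finite V"
    and ran: "X ` space M \<subseteq> insert None (Some ` V)"
    and le: "\<And>v. v \<in> V \<Longrightarrow> prob (X -` {Some v} \<inter> space M) \<le> d"
  shows "\<H>(X) \<le> 3 * real (card V) * sqrt d"
proof -
  let ?p = "\<lambda>v. prob (X -` {v} \<inter> space M)"
  have fin: "finite (insert None (Some ` V))"
    using \<open>finite V\<close> by simp
  have ms: "X -` {v} \<inter> space M \<in> events" for v
    using X by (rule simple_functionD)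
  have "1 = prob (\<Union>v\<in>insert None (Some ` V). X -` {v} \<inter> space M)"
    using ran by (subst prob_space[symmetric]) (intro arg_cong[where f = prob], auto)
  also have "\<dots> = (\<Sum>v\<in>insert None (Some ` V). ?p v)"
    using fin ms by (intro finite_measure_finite_Union) (auto simp: disjoint_family_on_def)
  finally have one: "1 - ?p None = (\<Sum>v\<in>V. ?p (Some v))"
    using \<open>finite V\<close> by (simp add: sum.reindex image_iff)
  have sq: "sqrt (?p (Some v)) \<le> sqrt d" if "v \<in> V" for v
    using le[OF that] by simp
  have p_le: "?p v \<le> sqrt (?p v)" for v
    by (simp add: real_le_rsqrt power2_eq_square mult_left_le_one_le)
  have "\<H>(X) = - (?p None * ln (?p None)) + (\<Sum>v\<in>V. - (?p (Some v) * ln (?p (Some v))))"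
    using \<open>finite V\<close> unfolding entropy_eq_sum[OF X fin ran]
    by (simp add: b log_def sum.reindex image_iff sum_negf)
  also have "\<dots> \<le> (\<Sum>v\<in>V. ?p (Some v)) + (\<Sum>v\<in>V. - (?p (Some v) * ln (?p (Some v))))"
    using minus_mult_ln_le(2)[of "?p None"] one by simp
  also have "\<dots> = (\<Sum>v\<in>V. ?p (Some v) - ?p (Some v) * ln (?p (Some v)))"
    by (simp add: sum.distrib[symmetric])
  also have "\<dots> \<le> (\<Sum>v\<in>V. 3 * sqrt d)"
  proof (rule sum_mono)
    fix v assume v: "v \<in> V"
    show "?p (Some v) - ?p (Some v) * ln (?p (Some v)) \<le> 3 * sqrt d"
      using minus_mult_ln_le(1)[OF measure_nonneg, of M "X -` {Some v} \<inter> space M"] p_le[of "Some v"] sq[OF v] by linarith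
  qed
  finally show ?thesis
    by (simp add: mult_ac)
qed

lemma (in information_space) H_sh_eq_entropy:
  assumes b: "b = exp 1" and "finite Q" and "Q \<subseteq> events" and "disjoint Q"
    and X: "simple_function M X" and AE: "AE x in M. X x \<in> Q \<and> x \<in> X x"
  shows "H_sh M Q = \<H>(X)"
proof -
  have ms: "X -` {A} \<inter> space M \<in> events" for A
    using X by (rule simple_functionD)
  have fin: "finite (Q \<union> X ` space M)"
    using \<open>finite Q\<close> X by (simp add: simple_function_def)
  have eq: "prob (X -` {A} \<inter> space M) = prob A" if "A \<in> Q" for A
  proof (rule finite_measure_eq_AE)
    have iff: "x \<in> X -` {A} \<inter> space M \<longleftrightarrow> x \<in> A" if "X x \<in> Q" "x \<in> X x" "x \<in> space M" for x
      using that \<open>A \<in> Q\<close> \<open>disjoint Q\<close> by (auto simp: disjoint_def)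
    show "AE x in M. x \<in> X -` {A} \<inter> space M \<longleftrightarrow> x \<in> A"
      using AE AE_space by eventually_elim (rule iff; simp)
  qed (use that assms ms in auto)
  have zero: "prob (X -` {A} \<inter> space M) = 0" if "A \<notin> Q" for A
  proof -
    have "AE x in M. x \<notin> X -` {A} \<inter> space M"
      using AE by eventually_elim (use that in auto)
    then show ?thesis
      using AE_iff_measurable[OF ms] by (simp add: prob_eq_0[OF ms])
  qed
  \<comment> \<open>On the exceptional null set \<open>X\<close> may take values outside
    \<open>Q\<close>; these are summed first and then dropped.\<close>
  have "\<H>(X) = - (\<Sum>A\<in>Q \<union> X ` space M. prob (X -` {A} \<inter> space M) * ln (prob (X -` {A} \<inter> space M)))"
    by (subst entropy_eq_sum[OF X fin]) (simp_all add: b log_def)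
  also have "\<dots> = - (\<Sum>A\<in>Q. prob (X -` {A} \<inter> space M) * ln (prob (X -` {A} \<inter> space M)))"
    using fin zero by (intro arg_cong[where f = uminus] sum.mono_neutral_right) auto
  finally show ?thesis
    by (simp add: H_sh_def eq)
qed

text \<open>Each newly inserted set takes precedence over the earlier choice. Points outside the
  union also get a member of \<open>\<A>\<close>, so the number of values is at most
  \<open>card \<A>\<close>.\<close>

lemma simple_function_selector:
  assumes "finite \<A>" and "\<A> \<noteq> {}" and "\<A> \<subseteq> sets M"
  shows "\<exists>c. simple_function M c \<and> (\<forall>x. c x \<in> \<A> \<and> (x \<in> \<Union>\<A> \<longrightarrow> x \<in> c x))"
  using assms
proof (induction rule: finite_ne_induct)
  case (singleton A)
  then show ?case by (intro exI[of _ "\<lambda>_. A"]) auto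
next
  case (insert A \<A>)
  then obtain c where c: "simple_function M c" "\<And>x. c x \<in> \<A>" "\<And>x. x \<in> \<Union>\<A> \<Longrightarrow> x \<in> c x"
    by auto
  have "simple_function M (\<lambda>x. if x \<in> A then A else c x)"
    using c insert.prems by (intro simple_function_If_set) auto
  then show ?case
    using c(2,3) by (intro exI[of _ "\<lambda>x. if x \<in> A then A else c x"]) auto
qed

text \<open>Base \<open>exp 1\<close> matches the natural logarithm in \<open>H_sh\<close>.\<close>

abbreviation shannon_entropy :: "'b measure \<Rightarrow> ('b \<Rightarrow> 'c) \<Rightarrow> real" where
  "shannon_entropy M X \<equiv> prob_space.entropy M (exp 1) (count_space (X ` space M)) X"

section \<open>Cylinders over partitions and open covers\<close>

lemma disjoint_eqI: "disjoint P \<Longrightarrow> A \<in> P \<Longrightarrow> B \<in> P \<Longrightarrow> x \<in> A \<Longrightarrow> x \<in> B \<Longrightarrow> A = B"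
  by (auto simp: disjoint_def)

lemma cylinder_in_cylinders: "(\<And>j. j < n \<Longrightarrow> A j \<in> P) \<Longrightarrow> cylinder n A \<in> cylinders n P"
  by (auto simp: cylinders_def)

lemma in_cylinder_iff: "x \<in> cylinder n A \<longleftrightarrow> (\<forall>j<n. x j \<in> A j)"
  by (simp add: cylinder_def)

lemma finite_cylinders:
  assumes "finite P"
  shows "finite (cylinders n P)"
proof (rule finite_subset)
  show "cylinders n P \<subseteq> cylinder n ` PiE {..<n} (\<lambda>_. P)"
  proof
    fix c assume "c \<in> cylinders n P"
    then obtain A where A: "c = cylinder n A" "\<forall>j<n. A j \<in> P"
      by (auto simp: cylinders_def)
    \<comment> \<open>Cylinders are indexed by infinite sequences; forgetting the entries from
      \<open>n\<close> on leaves finitely many.\<close>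
    then have "c = cylinder n (restrict A {..<n})"
      by (auto simp: cylinder_def)
    with A show "c \<in> cylinder n ` PiE {..<n} (\<lambda>_. P)"
      by auto
  qed
  show "finite (cylinder n ` PiE {..<n} (\<lambda>_. P))"
    using assms by (intro finite_imageI finite_PiE) auto
qed

lemma disjoint_cylinders:
  assumes "disjoint P"
  shows "disjoint (cylinders n P)"
proof (rule disjointI)
  fix c d assume cd: "c \<in> cylinders n P" "d \<in> cylinders n P" "c \<noteq> d"
  then obtain A B where A: "c = cylinder n A" "\<forall>j<n. A j \<in> P"
    and B: "d = cylinder n B" "\<forall>j<n. B j \<in> P"
    by (auto simp: cylinders_def)
  show "c \<inter> d = {}"
  proof (rule ccontr)
    assume "c \<inter> d \<noteq> {}"
    then obtain x where "\<forall>j<n. x j \<in> A j" "\<forall>j<n. x j \<in> B j"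
      using A B by (auto simp: cylinder_def)
    then have "\<forall>j<n. A j = B j"
      using A B disjoint_eqI[OF assms] by blast
    then show False
      using cd A B by (auto simp: cylinder_def)
  qed
qed

lemma Union_cylinders:
  assumes "\<Union>\<U> = UNIV"
  shows "\<Union>(cylinders n \<U>) = UNIV"
proof -
  have "\<exists>A. A \<in> \<U> \<and> y \<in> A" for y
    using assms by auto
  then obtain f where "\<And>y. f y \<in> \<U>" "\<And>y. y \<in> f y"
    by metis
  then have "cylinder n (f \<circ> x) \<in> cylinders n \<U>" "x \<in> cylinder n (f \<circ> x)" for x
    by (auto intro: cylinder_in_cylinders simp: in_cylinder_iff)
  then show ?thesis
    by blast
qed

lemma open_cylinders:
  assumes "\<forall>U\<in>\<U>. open U" and "c \<in> cylinders n \<U>"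
  shows "open c"
proof -
  obtain A where A: "c = cylinder n A" "\<forall>j<n. A j \<in> \<U>"
    using assms by (auto simp: cylinders_def)
  have "cylinder n A = (\<Inter>j<n. (\<lambda>x. x j) -` A j)"
    by (auto simp: cylinder_def)
  then show ?thesis
    using A assms by (auto intro!: open_vimage)
qed

section \<open>Stationary measures on the sequence space\<close>

context
  fixes \<mu> :: "(nat \<Rightarrow> 'a::topological_space) measure"
  assumes sets_\<mu>: "sets \<mu> = sets (PiM UNIV (\<lambda>_. (borel :: 'a measure)))"
begin

lemma space_sequences: "space \<mu> = UNIV"
  using sets_eq_imp_space_eq[OF sets_\<mu>] by (simp add: space_PiM)

lemma measurable_coordinate: "(\<lambda>x. x j) \<in> measurable \<mu> borel"
  unfolding measurable_cong_sets[OF sets_\<mu> refl] by (rule measurable_component_singleton) simp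

lemma sets_cylinders:
  assumes "P \<subseteq> sets borel"
  shows "cylinders n P \<subseteq> sets \<mu>"
proof
  fix c assume "c \<in> cylinders n P"
  then obtain A where A: "c = cylinder n A" "\<And>j. j < n \<Longrightarrow> A j \<in> sets borel"
    using assms by (auto simp: cylinders_def)
  have "{x \<in> space \<mu>. \<forall>j\<in>{..<n}. x j \<in> A j} \<in> sets \<mu>"
    using A by (intro sets.sets_Collect_finite_All measurable_sets_Collect[OF measurable_coordinate]) auto
  then show "c \<in> sets \<mu>"
    using A by (simp add: cylinder_def space_sequences lessThan_iff Ball_def)
qed

lemma measure_coordinate_stationary:
  assumes "stationary \<mu>" and "A \<in> sets borel"
  shows "measure \<mu> {x. x j \<in> A} = measure \<mu> {x. x 0 \<in> A}"
proof (induction j)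
  case (Suc j)
  have "shift \<in> measurable \<mu> \<mu>"
    unfolding measurable_cong_sets[OF sets_\<mu> sets_\<mu>] shift_def
    by (rule measurable_PiM_single') (auto intro: measurable_component_singleton)
  moreover have "{x. x j \<in> A} \<in> sets \<mu>"
    using measurable_sets[OF measurable_coordinate assms(2)] by (simp add: space_sequences vimage_def)
  ultimately have "measure (distr \<mu> \<mu> shift) {x. x j \<in> A} = measure \<mu> {x. x (Suc j) \<in> A}"
    by (simp add: measure_distr space_sequences shift_def vimage_def)
  then show ?case
    using Suc assms(1) by (simp add: stationary_def)
qed simp

lemma simple_function_coordinate:
  assumes "simple_function (borel :: 'a measure) r"
  shows "simple_function \<mu> (\<lambda>x. r (x j))"
proof -
  have "range r = r ` space borel"
    by simp
  then have "finite (range r)"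
    using assms simple_functionD(1) by metis
  moreover have "(\<lambda>x. r (x j)) -` {v} \<inter> space \<mu> \<in> sets \<mu>" for v
    using measurable_sets[OF measurable_coordinate simple_functionD(2)[OF assms, of "{v}"]]
    by (simp add: vimage_def)
  moreover have "(\<lambda>x. r (x j)) ` space \<mu> \<subseteq> range r"
    by auto
  ultimately show ?thesis
    unfolding simple_function_def by (auto intro: finite_subset)
qed

text \<open>By \<open>decode\<close>, a member of \<open>\<U>\<close> containing \<open>y\<close>
  together with the side information \<open>r y\<close> determines the cell of \<open>y\<close> in
  \<open>P\<close>. Applied letter by letter, a member of \<open>\<A>\<close> and the
  \<open>r\<close>-word determine the \<open>P\<close>-word, and subadditivity splits the
  cost.\<close>

lemma H_sh_cylinders_le:
  assumes \<mu>: "prob_space \<mu>" "stationary \<mu>"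
    and P: "finite P" "P \<subseteq> sets borel" "disjoint P"
    and \<U>: "\<U> \<subseteq> sets borel"
    and r: "simple_function (borel :: 'a measure) r"
    and decode: "\<And>V. V \<in> \<U> \<Longrightarrow> \<exists>g. \<forall>y\<in>V. g (r y) \<in> P \<and> y \<in> g (r y)"
    and \<A>: "finite \<A>" "\<A> \<subseteq> cylinders n \<U>" "AE x in \<mu>. x \<in> \<Union>\<A>"
  shows "H_sh \<mu> (cylinders n P) \<le>
    ln (card \<A>) + n * shannon_entropy \<mu> (\<lambda>x. r (x 0))"
proof -
  interpret prob_space \<mu> by fact
  interpret information_space \<mu> "exp 1" by unfold_locales simp
  obtain g where g: "\<And>V y. V \<in> \<U> \<Longrightarrow> y \<in> V \<Longrightarrow> g V (r y) \<in> P \<and> y \<in> g V (r y)"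
    using decode by metis
  have "\<forall>c\<in>cylinders n \<U>. \<exists>A. c = cylinder n A \<and> (\<forall>j<n. A j \<in> \<U>)"
    by (auto simp: cylinders_def)
  \<comment> \<open>One cylinder may be written with several words; \<open>A c\<close> fixes one of
    them.\<close>
  then obtain A where A: "\<And>c. c \<in> cylinders n \<U> \<Longrightarrow> c = cylinder n (A c)"
    "\<And>c j. c \<in> cylinders n \<U> \<Longrightarrow> j < n \<Longrightarrow> A c j \<in> \<U>"
    by metis
  have ne: "\<A> \<noteq> {}"
    using \<A>(3) by (auto simp: AE_False)
  have "\<A> \<subseteq> events"
    using \<A>(2) sets_cylinders[OF \<U>] by blast
  from simple_function_selector[OF \<A>(1) ne this]
  obtain c where c: "simple_function \<mu> c" "\<And>x. c x \<in> \<A>" "\<And>x. x \<in> \<Union>\<A> \<Longrightarrow> x \<in> c x"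
    by blast
  define Z where "Z x = map (\<lambda>j. r (x j)) [0..<n]" for x :: "nat \<Rightarrow> 'a"
  \<comment> \<open>The decoder: position \<open>j\<close> is decoded by the function chosen for the
    \<open>j\<close>-th factor of the covering cylinder \<open>c\<close>.\<close>
  define F where "F = (\<lambda>(c, z). cylinder n (\<lambda>j. g (A c j) (z ! j)))"
  have rj: "simple_function \<mu> (\<lambda>x. r (x j))" for j
    by (rule simple_function_coordinate[OF r])
  then have Z: "simple_function \<mu> Z"
    unfolding Z_def[abs_def] by (rule simple_function_map_upt)
  have F: "F (c x, Z x) \<in> cylinders n P \<and> x \<in> F (c x, Z x)" if "x \<in> \<Union>\<A>" for x
  proof -
    have cx: "c x \<in> cylinders n \<U>"
      using c(2) \<A>(2) by blast
    then have "x \<in> cylinder n (A (c x))"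
      using A(1) c(3)[OF that] by auto
    then have "g (A (c x) j) (Z x ! j) \<in> P \<and> x j \<in> g (A (c x) j) (Z x ! j)" if "j < n" for j
      using g[OF A(2)[OF cx that]] that by (simp add: cylinder_def Z_def)
    then show ?thesis
      unfolding F_def by (auto intro: cylinder_in_cylinders simp: in_cylinder_iff)
  qed
  have "H_sh \<mu> (cylinders n P) = shannon_entropy \<mu> (F \<circ> (\<lambda>x. (c x, Z x)))"
  proof (rule H_sh_eq_entropy[OF refl finite_cylinders[OF P(1)] sets_cylinders[OF P(2)]
      disjoint_cylinders[OF P(3)]])
    show "simple_function \<mu> (F \<circ> (\<lambda>x. (c x, Z x)))"
      using c(1) Z by blast
    show "AE x in \<mu>. (F \<circ> (\<lambda>x. (c x, Z x))) x \<in> cylinders n P \<and> x \<in> (F \<circ> (\<lambda>x. (c x, Z x))) x"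
      using \<A>(3) by eventually_elim (use F in simp)
  qed
  also have "\<dots> \<le> shannon_entropy \<mu> (\<lambda>x. (c x, Z x))"
    by (rule entropy_data_processing) (use c(1) Z in blast)
  also have "\<dots> \<le> shannon_entropy \<mu> c + shannon_entropy \<mu> Z"
    using c(1) Z by (rule entropy_Pair_le)
  \<comment> \<open>Entropy is at most the logarithm of the number of values, and all values of
    \<open>c\<close> lie in \<open>\<A>\<close>.\<close>
  also have "shannon_entropy \<mu> c \<le> ln (card \<A>)"
  proof -
    have "shannon_entropy \<mu> c \<le> log (exp 1) (card (c ` space \<mu>))"
      by (rule entropy_le_card[OF simple_distributedI[OF c(1) measure_nonneg refl]])
    also have "\<dots> = ln (card (c ` space \<mu>))"
      by (simp add: log_def)
    also have "\<dots> \<le> ln (card \<A>)"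
    proof -
      have "card (c ` space \<mu>) \<le> card \<A>"
        using c(2) by (intro card_mono \<A>(1)) auto
      moreover have "0 < card (c ` space \<mu>)"
        using c(1) not_empty by (simp add: card_gt_0_iff simple_functionD(1))
      ultimately show ?thesis
        by simp
    qed
    finally show ?thesis .
  qed
  also have "shannon_entropy \<mu> Z \<le> (\<Sum>j<n. shannon_entropy \<mu> (\<lambda>x. r (x j)))"
    unfolding Z_def[abs_def] using rj by (rule entropy_map_upt_le)
  \<comment> \<open>Stationarity gives every \<open>r (x j)\<close> the law of
    \<open>r (x 0)\<close>; the common index set \<open>range r\<close> makes the two sums agree
    term by term.\<close>
  also have "\<dots> = (\<Sum>j<n. shannon_entropy \<mu> (\<lambda>x. r (x 0)))"
  proof (rule sum.cong[OF refl])
    fix j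
    have fin: "finite (range r)"
      using simple_functionD(1)[OF r] by simp
    have "prob ((\<lambda>x. r (x j)) -` {v} \<inter> space \<mu>) = prob ((\<lambda>x. r (x 0)) -` {v} \<inter> space \<mu>)" for v
      using measure_coordinate_stationary[OF \<mu>(2) simple_functionD(2)[OF r, of "{v}"], of j]
      by (simp add: vimage_def space_sequences)
    then show "shannon_entropy \<mu> (\<lambda>x. r (x j)) = shannon_entropy \<mu> (\<lambda>x. r (x 0))"
      by (subst (1 2) entropy_eq_sum[OF rj fin]) auto
  qed
  also have "\<dots> = n * shannon_entropy \<mu> (\<lambda>x. r (x 0))"
    by simp
  finally show ?thesis
    by simp
qed

end

section \<open>The cover attached to a partition, and the limit\<close>

text \<open>The open cover built in the proof depends on \<open>d\<close>, but the supremum in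
  \<open>H_tip\<close> absorbs this, so for fixed \<open>P\<close> the error term can be made
  arbitrarily small.\<close>

lemma H_ip_part_le_H_tip_plus:
  fixes S :: "(nat \<Rightarrow> 'a::topological_space) set"
    and \<mu> :: "(nat \<Rightarrow> 'a) measure"
  assumes comp: "compact (UNIV :: 'a set)"
    and met: "metrizable_space (euclidean :: 'a topology)"
    and prob: "prob_space \<mu>"
    and sets_\<mu>: "sets \<mu> = sets (PiM UNIV (\<lambda>_::nat. (borel :: 'a measure)))"
    and stat: "stationary \<mu>"
    and supp: "top_support \<mu> \<subseteq> S"
    and P: "meas_partition (borel :: 'a measure) P"
    and d: "d > 0"
  shows "H_ip_part \<mu> P \<le> H_tip S + ereal (3 * real (card P) * sqrt d)"
proof -
  interpret prob_space \<mu> by fact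
  interpret information_space \<mu> "exp 1" by unfold_locales simp
  note space_\<mu> = space_sequences[OF sets_\<mu>]
  note coord = measurable_coordinate[OF sets_\<mu>]
  have P: "finite P" "P \<subseteq> sets borel" "disjoint P" "\<Union>P = UNIV"
    using P by (auto simp: meas_partition_def)
  \<comment> \<open>The law of one coordinate, which decides how closely the cells must be
    approximated by closed sets.\<close>
  define \<nu> where "\<nu> = distr \<mu> borel (\<lambda>x. x 0)"
  have \<nu>: "finite_measure \<nu>" "sets \<nu> = sets borel"
    unfolding \<nu>_def using prob_space_distr[OF coord] by (auto simp: prob_space_def)
  have "\<exists>C. closed C \<and> C \<subseteq> A \<and> measure \<nu> (A - C) \<le> d" if "A \<in> P" for A
  proof -
    have "A \<in> sets borel"
      using P(2) that by blast
    then obtain C U where C: "closed C" "open U" "C \<subseteq> A" "A \<subseteq> U" "measure \<nu> (U - C) < d"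
      using regular_metrizable[OF met \<nu> _ d] by metis
    have "measure \<nu> (A - C) \<le> measure \<nu> (U - C)"
      using C by (intro finite_measure.finite_measure_mono[OF \<nu>(1)]) (auto simp: \<nu>(2))
    with C show ?thesis
      by (intro exI[of _ C]) simp
  qed
  then obtain B where B: "\<And>A. A \<in> P \<Longrightarrow> closed (B A)" "\<And>A. A \<in> P \<Longrightarrow> B A \<subseteq> A"
    "\<And>A. A \<in> P \<Longrightarrow> measure \<nu> (A - B A) \<le> d"
    by metis
  have "\<forall>y. \<exists>A. A \<in> P \<and> y \<in> A"
    using P(4) by auto
  then obtain cell where cell: "\<And>y. cell y \<in> P" "\<And>y. y \<in> cell y"
    by metis
  have cell_eq: "cell y = A" if "A \<in> P" "y \<in> A" for A y
    using disjoint_eqI[OF P(3) cell(1) that(1) cell(2) that(2)] .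
  define r where "r y = (if y \<in> B (cell y) then None else Some (cell y))" for y
  define W where "W A = - \<Union>(B ` (P - {A}))" for A
  let ?\<U> = "W ` P"
  \<comment> \<open>\<open>W A\<close> avoids every closed core except \<open>B A\<close>, so a core
    point of \<open>W A\<close> can only belong to \<open>A\<close>.\<close>
  have W: "y \<in> B (cell y) \<Longrightarrow> y \<in> W A \<Longrightarrow> cell y = A" for y A
    using cell(1) by (auto simp: W_def)
  \<comment> \<open>The cores of the other cells lie in those cells, hence miss
    \<open>y\<close>.\<close>
  have cellW: "y \<in> W (cell y)" for y
    using B(2) cell_eq by (fastforce simp: W_def)
  have "open (W A)" for A
    unfolding W_def by (intro open_Compl closed_UN) (use P(1) B(1) in auto)
  then have cover: "open_cover ?\<U>"
    using cellW cell(1) by (fastforce simp: open_cover_def)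
  have r_None: "r -` {None} = (\<Union>A\<in>P. B A)"
  proof -
    have "y \<in> B (cell y)" if "A \<in> P" "y \<in> B A" for y A
      using that B(2) cell_eq by blast
    then show ?thesis
      by (auto simp: r_def split: if_splits intro!: bexI[OF _ cell(1)])
  qed
  have r_Some: "r -` {Some A} = A - B A" if "A \<in> P" for A
  proof -
    have "cell y = A \<longleftrightarrow> y \<in> A" for y
      using cell_eq[OF that, of y] cell(2)[of y] by metis
    moreover have "r y = Some A \<longleftrightarrow> cell y = A \<and> y \<notin> B A" for y
      by (auto simp: r_def)
    ultimately show ?thesis
      by auto
  qed
  have r_range: "range r \<subseteq> insert None (Some ` P)"
    by (auto simp: r_def cell(1))
  have r: "simple_function (borel :: 'a measure) r"
    unfolding simple_function_def
  proof (intro conjI ballI)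
    show "finite (r ` space borel)"
      using finite_subset[OF r_range] P(1) by simp
    fix v assume "v \<in> r ` space borel"
    then consider "v = None" | A where "A \<in> P" "v = Some A"
      using r_range by auto
    then show "r -` {v} \<inter> space borel \<in> sets borel"
      using P(1,2) B(1) by cases (auto simp: r_None r_Some)
  qed
  have decode: "\<exists>g. \<forall>y\<in>V. g (r y) \<in> P \<and> y \<in> g (r y)" if V: "V \<in> ?\<U>" for V
  proof -
    obtain A where "V = W A"
      using V by auto
    \<comment> \<open>The decoder answers \<open>A\<close> on \<open>None\<close> and otherwise
      returns the cell that \<open>r\<close> reveals.\<close>
    then show ?thesis
      using cell W by (intro exI[of _ "\<lambda>v. case v of None \<Rightarrow> A | Some A' \<Rightarrow> A'"]) (auto simp: r_def)
  qed
  have h_le: "shannon_entropy \<mu> (\<lambda>x. r (x 0)) \<le> 3 * real (card P) * sqrt d"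
  proof (rule entropy_option_le[OF refl simple_function_coordinate[OF sets_\<mu> r] P(1)])
    show "(\<lambda>x. r (x 0)) ` space \<mu> \<subseteq> insert None (Some ` P)"
      using r_range by auto
    fix A assume A: "A \<in> P"
    then have "measure \<nu> (A - B A) = prob ((\<lambda>x. r (x 0)) -` {Some A} \<inter> space \<mu>)"
      using P(2) B(1)[OF A] r_Some[OF A] unfolding \<nu>_def
      by (subst measure_distr[OF coord]) (auto simp: vimage_def set_eq_iff)
    then show "prob ((\<lambda>x. r (x 0)) -` {Some A} \<inter> space \<mu>) \<le> d"
      using B(3)[OF A] by simp
  qed
  have bound: "H_sh \<mu> (cylinders n P) \<le>
      ln (cover_number S (cylinders n ?\<U>)) + n * (3 * real (card P) * sqrt d)" for n
  proof -
    let ?F = "{\<A>. finite \<A> \<and> \<A> \<subseteq> cylinders n ?\<U> \<and> S \<subseteq> \<Union>\<A>}"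
    \<comment> \<open>The infimum of a nonempty set of naturals is attained; the finite family of
      all cylinders over \<open>?\<U>\<close> shows nonemptiness.\<close>
    have "cylinders n ?\<U> \<in> ?F"
      using finite_cylinders[of ?\<U> n] Union_cylinders[of ?\<U> n] P(1) cover
      by (simp add: open_cover_def)
    then have "cover_number S (cylinders n ?\<U>) \<in> card ` ?F"
      unfolding cover_number_def by (intro Inf_nat_def1) blast
    then obtain \<A> where \<A>: "finite \<A>" "\<A> \<subseteq> cylinders n ?\<U>" "S \<subseteq> \<Union>\<A>"
      "card \<A> = cover_number S (cylinders n ?\<U>)"
      by auto
    have \<U>: "?\<U> \<subseteq> sets borel"
      using cover by (auto simp: open_cover_def)
    \<comment> \<open>\<open>S\<close> is arbitrary and may fail to be measurable; the union of the
      finite subcover is open, measurable and contains the support.\<close>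
    have "AE x in \<mu>. x \<in> \<Union>\<A>"
    proof (rule open_superset_top_support[OF compact_UNIV_fun[OF comp] prob space_\<mu>])
      show "open (\<Union>\<A>)"
        using \<A>(2) cover unfolding open_cover_def by (blast intro: open_cylinders)
      show "\<Union>\<A> \<in> sets \<mu>"
        using \<A>(1,2) sets_cylinders[OF sets_\<mu> \<U>] by (intro sets.finite_Union) auto
      show "top_support \<mu> \<subseteq> \<Union>\<A>"
        using supp \<A>(3) by blast
    qed
    from H_sh_cylinders_le[OF sets_\<mu> prob stat P(1-3) \<U> r decode \<A>(1,2) this]
    have "H_sh \<mu> (cylinders n P) \<le> ln (card \<A>) + n * shannon_entropy \<mu> (\<lambda>x. r (x 0))"
      by (simp add: space_\<mu>)
    also have "\<dots> \<le> ln (card \<A>) + n * (3 * real (card P) * sqrt d)"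
      using h_le by (intro add_left_mono mult_left_mono) auto
    finally show ?thesis
      by (simp add: \<A>(4))
  qed
  have "H_ip_part \<mu> P \<le> limsup (\<lambda>n. ereal (ln (cover_number S (cylinders n ?\<U>)) / n) +
      ereal (3 * real (card P) * sqrt d))"
    unfolding H_ip_part_def
  proof (rule Limsup_mono, rule eventually_mono[OF eventually_gt_at_top[of 0]])
    fix n :: nat assume "0 < n"
    then show "ereal (H_sh \<mu> (cylinders n P) / n) \<le>
        ereal (ln (cover_number S (cylinders n ?\<U>)) / n) + ereal (3 * real (card P) * sqrt d)"
      using bound[of n] by (simp add: field_simps)
  qed
  \<comment> \<open>The error is a finite constant, so it leaves the limsup even when that is
    infinite.\<close>
  also have "\<dots> = H_tip_cover S ?\<U> + ereal (3 * real (card P) * sqrt d)"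
    unfolding H_tip_cover_def by (rule Limsup_add_ereal_right) auto
  also have "\<dots> \<le> H_tip S + ereal (3 * real (card P) * sqrt d)"
    unfolding H_tip_def by (intro add_right_mono SUP_upper) (use cover in simp)
  finally show ?thesis .
qed

theorem proposition3p2:
  fixes S :: "(nat \<Rightarrow> 'a::topological_space) set"
    and \<mu> :: "(nat \<Rightarrow> 'a) measure"
  assumes "compact (UNIV :: 'a set)"
    and "metrizable_space (euclidean :: 'a topology)"
    and "prob_space \<mu>"
    and "sets \<mu> = sets (PiM UNIV (\<lambda>_::nat. (borel :: 'a measure)))"
    and "stationary \<mu>"
    and "top_support \<mu> \<subseteq> S"
  shows "H_ip \<mu> \<le> H_tip S"
  unfolding H_ip_def
proof (rule SUP_least)
  fix P assume "P \<in> {P. meas_partition (borel :: 'a measure) P}"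
  then have P: "meas_partition (borel :: 'a measure) P"
    by simp
  show "H_ip_part \<mu> P \<le> H_tip S"
  proof (rule ereal_le_epsilon2)
    fix e :: real assume "0 < e"
    \<comment> \<open>Chosen so that \<open>3 * (card P + 1) * sqrt d = e\<close>; the summand
      \<open>1\<close> keeps the denominator positive for every value of
      \<open>card P\<close>.\<close>
    define d where "d = (e / (3 * (real (card P) + 1)))\<^sup>2"
    have "sqrt d = e / (3 * (real (card P) + 1))"
      using \<open>0 < e\<close> by (simp add: d_def)
    then have "3 * real (card P) * sqrt d + 3 * sqrt d = e"
      by (simp add: field_simps)
    moreover have "0 \<le> sqrt d"
      by (simp add: d_def)
    ultimately have "3 * real (card P) * sqrt d \<le> e"
      by linarith
    moreover have "0 < d"
      using \<open>0 < e\<close> by (simp add: d_def add_nonneg_eq_0_iff)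
    ultimately show "H_ip_part \<mu> P \<le> H_tip S + ereal e"
      using H_ip_part_le_H_tip_plus[OF assms P, of d]
      by (meson add_left_mono ereal_less_eq(3) order_trans)
  qed
qed

end
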